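(* Let $\chi=\{(E_c\cdot\mathcal A\cdot e^{\mathrm j\Phi})_{c\in\mathcal I}\in\mathcal H:\Phi\in\mathbb R^{n\times n}\}$ and suppose that the amplitude $\mathcal A\in\mathbb R_+^{n\times n}$ is nonzero everywhere (in every entry). Then the set $A_\chi=\{(x,x,\dots,x)\in\mathcal H^m: x\in\chi\}$ is prox-regular at every point $[\hat x]_m=(\hat x,\hat x,\dots,\hat x)$ with $\hat x\in\chi$.
   Context: Let $n,m\ge1$ be integers. Products, exponentials and equalities of $n\times n$ arrays are elementwise; $\mathrm j=\sqrt{-1}$; indices are $\xi=(\xi_1,\xi_2)$, $1\le\xi_1,\xi_2\le n$, and $w[\xi]$ is the entry of $w$ at $\xi$. Let $\mathcal I=\{XX,XY,XZ,YX,YY,YZ\}$ and $\mathcal H=(\mathbb C^{n\times n})^6$, with elements $x=(x_c)_{c\in\mathcal I}$, with Frobenius norm $\|x\|^2=\sum_{c\in\mathcal I}\sum_\xi|x_c[\xi]|^2$; $\mathcal H^m$ carries the norm $\|(w_1,\dots,w_m)\|^2=\sum_d\|w_d\|^2$. For a set $\Omega$, $P_\Omega(x)=\{w\in\Omega:\|x-w\|=\inf_{v\in\Omega}\|x-v\|\}$. The matrices $E_c$: for every index $\xi$ (sampling point of the lens aperture) let $(k_X,k_Y,k_Z)=(k_X[\xi],k_Y[\xi],k_Z[\xi])\in\mathbb R^3$ be a unit vector (the unit wave vector) with $1+k_Z\neq0$. The real $n\times n$ matrices $E_c$ are given entrywise by $E_{XX}=1-\frac{k_X^2}{1+k_Z}$,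 $E_{XY}=E_{YX}=-\frac{k_Xk_Y}{1+k_Z}$, $E_{YY}=1-\frac{k_Y^2}{1+k_Z}$, $E_{XZ}=-k_X$, $E_{YZ}=-k_Y$; they satisfy $\sum_{c\in\mathcal I}E_c^2=2$ in every entry. Definition (prox-regularity). A set $\Omega$ is prox-regular at a point $\hat x\in\Omega$ if its projector $P_\Omega$ is single-valued around $\hat x$, i.e. on some neighborhood of $\hat x$. *)

theory Defs
  imports "HOL-Analysis.Analysis"
begin

datatype chan = XX | XY | XZ | YX | YY | YZ

lemma UNIV_chan: "(UNIV :: chan set) = {XX, XY, XZ, YX, YY, YZ}"
  using chan.exhaust by blast

instance chan :: finite
  by standard (simp add: UNIV_chan)

text \<open>
  The norm of type \<^typ>\<open>complex ^ 'n ^ 'n ^ chan\<close> provided by the library is the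
  \<open>\<ell>\<^sup>2\<close>-norm of the norms of the components, i.e. the Frobenius norm; likewise
  for \<open>m\<close>-tuples of such elements. The entry of \<open>w\<close> at \<open>\<xi> = (i, j)\<close> is \<open>w $ i $ j\<close>.
\<close>

type_synonym 'n hspace = "complex ^ 'n ^ 'n ^ chan"

definition projector :: "'a::real_normed_vector set \<Rightarrow> 'a \<Rightarrow> 'a set" where
  "projector \<Omega> x = {w \<in> \<Omega>. norm (x - w) = (INF v\<in>\<Omega>. norm (x - v))}"

definition prox_regular_at :: "'a::real_normed_vector set \<Rightarrow> 'a \<Rightarrow> bool" where
  "prox_regular_at \<Omega> p \<longleftrightarrow>
     p \<in> \<Omega> \<and> (\<exists>U. open U \<and> p \<in> U \<and> (\<forall>x\<in>U. \<exists>w. projector \<Omega> x = {w}))"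

text \<open>
  The components 1, 2, 3 of \<open>k $ i $ j\<close> are the values of \<open>k\<^sub>X\<close>, \<open>k\<^sub>Y\<close>, \<open>k\<^sub>Z\<close> at \<open>(i, j)\<close>.
\<close>

fun E_entry :: "chan \<Rightarrow> real ^ 3 \<Rightarrow> real" where
  "E_entry XX k = 1 - (k $ 1)\<^sup>2 / (1 + k $ 3)"
| "E_entry XY k = - (k $ 1 * k $ 2) / (1 + k $ 3)"
| "E_entry YX k = - (k $ 1 * k $ 2) / (1 + k $ 3)"
| "E_entry YY k = 1 - (k $ 2)\<^sup>2 / (1 + k $ 3)"
| "E_entry XZ k = - (k $ 1)"
| "E_entry YZ k = - (k $ 2)"

definition E_mat :: "real ^ 3 ^ 'n ^ 'n \<Rightarrow> chan \<Rightarrow> real ^ 'n ^ 'n" where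
  "E_mat k c = (\<chi> i j. E_entry c (k $ i $ j))"

lemma sum_E_mat_squares:
  fixes k :: "real ^ 3 ^ 'n ^ 'n"
  assumes "norm (k $ i $ j) = 1" and "1 + k $ i $ j $ 3 \<noteq> 0"
  shows "(\<Sum>c\<in>UNIV. (E_mat k c $ i $ j)\<^sup>2) = 2"
proof -
  define a b z where "a = k $ i $ j $ 1" and "b = k $ i $ j $ 2" and "z = k $ i $ j $ 3"
  have s: "a\<^sup>2 + b\<^sup>2 + z\<^sup>2 = 1"
    using assms(1) by (simp add: norm_vec_def L2_set_def sum_3 a_def b_def z_def)
  have nz: "1 + z \<noteq> 0" using assms(2) by (simp add: z_def)
  define t where "t = inverse (1 + z)"
  have t: "t * (1 + z) = 1" using nz by (simp add: t_def)
  have "(1 - a\<^sup>2 * t)\<^sup>2 + 2 * (a * b * t)\<^sup>2 + (1 - b\<^sup>2 * t)\<^sup>2 + a\<^sup>2 + b\<^sup>2 = 2"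
    using s t by algebra
  then show ?thesis
    by (simp add: UNIV_chan E_mat_def a_def b_def z_def t_def divide_inverse algebra_simps)
qed

definition chi_set :: "(chan \<Rightarrow> real ^ 'n ^ 'n) \<Rightarrow> real ^ 'n ^ 'n \<Rightarrow> ('n::finite) hspace set" where
  "chi_set E A =
     {(\<chi> c i j. complex_of_real (E c $ i $ j) * complex_of_real (A $ i $ j)
                 * exp (\<i> * complex_of_real (\<Phi> $ i $ j))) | \<Phi>. True}"

definition diag :: "'a \<Rightarrow> 'a ^ 'm" where
  "diag x = (\<chi> d. x)"

end

theory Submission
  imports Defs
begin

text \<open>
  All candidates in the set have the same norm: the amplitudes are prescribed, only the phases vary.
  On a sphere, being nearest to \<open>X\<close> means maximising the real inner product with \<open>X\<close>, which is
  linear in the candidate (\<open>projector_eq_if_strict_inner_max\<close>). A candidate is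
  \<open>phase_field E A u\<close> for an array \<open>u\<close> of unimodular numbers, and passing to the adjoint
  \<open>aggregate E A\<close> (\<open>inner_phase_field\<close>) decouples the maximisation: at each
  index a unimodular \<open>u[\<xi>]\<close> has to be aligned with the single complex number
  \<open>aggregate E A X[\<xi>]\<close>. The best choice is unique as soon as this number is nonzero
  (\<open>inner_unimodular_less\<close>).

  Finally \<open>aggregate E A (phase_field E A u)\<close> is \<open>u\<close> scaled entrywise by
  \<open>2 m \<A>\<^sup>2\<close>, because the squares of the \<open>E\<^sub>c\<close> sum to \<open>2\<close>. Since \<open>\<A>\<close> vanishes nowhere, all
  aggregates are nonzero at every point of the set, hence by continuity on a whole neighbourhood.
\<close>

section \<open>Nearest points in a subset of a sphere\<close>

lemma projector_eq_if_strict_inner_max: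
  fixes \<Omega> :: "'a::real_inner set"
  assumes w: "w \<in> \<Omega>"
    and sphere: "\<And>v. v \<in> \<Omega> \<Longrightarrow> norm v = norm w"
    and max: "\<And>v. v \<in> \<Omega> \<Longrightarrow> v \<noteq> w \<Longrightarrow> inner x v < inner x w"
  shows "projector \<Omega> x = {w}"
proof -
  have less: "norm (x - w) < norm (x - v)" if v: "v \<in> \<Omega>" "v \<noteq> w" for v
  proof -
    have "inner v v = inner w w"
      using sphere[OF v(1)] by (simp add: norm_eq)
    then have "(norm (x - w))\<^sup>2 < (norm (x - v))\<^sup>2"
      using max[OF v] by (simp add: power2_norm_eq_inner inner_diff_left inner_diff_right inner_commute)
    then show ?thesis
      by (rule power2_less_imp_less) simp
  qed
  then have "(INF v\<in>\<Omega>. norm (x - v)) = norm (x - w)"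
    using w by (intro cInf_eq_minimum) force+
  then show ?thesis
    using w less by (fastforce simp: projector_def)
qed

section \<open>Aligning an array of phases\<close>

lemma inner_unimodular_less_complex:
  fixes s z :: complex
  assumes "s \<noteq> 0" "norm z = 1" "z \<noteq> sgn s"
  shows "inner s z < inner s (sgn s)"
proof -
  have sgn: "inner s (sgn s) = norm s"
    using assms(1) by (simp add: sgn_div_norm dot_square_norm power2_eq_square)
  have "inner s z \<noteq> norm s * norm z"
  proof
    assume "inner s z = norm s * norm z"
    then have "norm s *\<^sub>R z = s"
      using norm_cauchy_schwarz_eq[of s z] unfolding assms(2) by (metis scaleR_one)
    then have "sgn s = inverse (norm s) *\<^sub>R (norm s *\<^sub>R z)"
      by (simp add: sgn_div_norm)
    then show False
      using assms(1,3) by simp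
  qed
  then show ?thesis
    using norm_cauchy_schwarz[of s z] assms(2) sgn by simp
qed

definition unimodular :: "(complex ^ 'n ^ 'n) set" where
  "unimodular = {u. \<forall>i j. norm (u $ i $ j) = 1}"

definition phases :: "complex ^ 'n ^ 'n \<Rightarrow> complex ^ 'n ^ 'n" where
  "phases s = (\<chi> i j. sgn (s $ i $ j))"

lemma unimodular_nonzero:
  assumes "u \<in> unimodular"
  shows "u $ i $ j \<noteq> 0"
proof -
  have "norm (u $ i $ j) = 1"
    using assms by (simp add: unimodular_def)
  then show ?thesis
    by auto
qed

lemma phases_unimodular: "(\<And>i j. s $ i $ j \<noteq> 0) \<Longrightarrow> phases s \<in> unimodular"
  by (simp add: unimodular_def phases_def norm_sgn)

text \<open>
  The inner product of arrays is a sum over the indices, so the entries can be aligned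
  independently, and one misaligned entry makes the sum strictly smaller.
\<close>

lemma inner_unimodular_less:
  fixes s u :: "complex ^ 'n ^ 'n"
  assumes nz: "\<And>i j. s $ i $ j \<noteq> 0" and u: "u \<in> unimodular" "u \<noteq> phases s"
  shows "inner s u < inner s (phases s)"
proof -
  have as_sum: "inner s v = (\<Sum>(i, j)\<in>UNIV. inner (s $ i $ j) (v $ i $ j))" for v
    by (simp add: inner_vec_def sum.cartesian_product)
  have less: "inner (s $ i $ j) (u $ i $ j) < inner (s $ i $ j) (phases s $ i $ j)"
    if "u $ i $ j \<noteq> phases s $ i $ j" for i j
    using that nz u(1) inner_unimodular_less_complex[of "s $ i $ j" "u $ i $ j"]
    by (simp add: unimodular_def phases_def)
  obtain i j where ij: "u $ i $ j \<noteq> phases s $ i $ j"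
    using u(2) by (auto simp: vec_eq_iff)
  show ?thesis
    unfolding as_sum
  proof (rule sum_strict_mono_ex1)
    show "\<forall>x\<in>UNIV. (case x of (i, j) \<Rightarrow> inner (s $ i $ j) (u $ i $ j))
      \<le> (case x of (i, j) \<Rightarrow> inner (s $ i $ j) (phases s $ i $ j))"
      using less by (force simp: order_le_less)
    show "\<exists>x\<in>UNIV. (case x of (i, j) \<Rightarrow> inner (s $ i $ j) (u $ i $ j))
      < (case x of (i, j) \<Rightarrow> inner (s $ i $ j) (phases s $ i $ j))"
      using less[OF ij] by (intro bexI[of _ "(i, j)"]) auto
  qed simp
qed

section \<open>Fields with prescribed amplitude and their aggregates\<close>

definition phase_field ::
  "(chan \<Rightarrow> real ^ 'n ^ 'n) \<Rightarrow> real ^ 'n ^ 'n \<Rightarrow> complex ^ 'n ^ 'n \<Rightarrow> ('n::finite) hspace ^ 'm" where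
  "phase_field E A u = diag (\<chi> c i j. (E c $ i $ j * A $ i $ j) *\<^sub>R u $ i $ j)"

definition aggregate ::
  "(chan \<Rightarrow> real ^ 'n ^ 'n) \<Rightarrow> real ^ 'n ^ 'n \<Rightarrow> ('n::finite) hspace ^ 'm \<Rightarrow> complex ^ 'n ^ 'n" where
  "aggregate E A X = (\<chi> i j. \<Sum>d\<in>UNIV. \<Sum>c\<in>UNIV. (E c $ i $ j * A $ i $ j) *\<^sub>R X $ d $ c $ i $ j)"

text \<open>
  Replacing the real phase functions by unimodular arrays removes the ambiguity modulo \<open>2\<pi>\<close>,
  so that uniqueness can be read off the parameter.
\<close>

lemma diag_chi_set_eq:
  "{diag x | x. x \<in> chi_set E A} = (phase_field E A ` unimodular :: ('n::finite hspace ^ 'm) set)"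
proof (intro equalityI subsetI)
  fix w :: "'n hspace ^ 'm"
  assume "w \<in> {diag x | x. x \<in> chi_set E A}"
  then obtain \<Phi> :: "real ^ 'n ^ 'n" where "w = diag (\<chi> c i j. complex_of_real (E c $ i $ j)
      * complex_of_real (A $ i $ j) * exp (\<i> * complex_of_real (\<Phi> $ i $ j)))"
    by (auto simp: chi_set_def)
  then have "w = phase_field E A (\<chi> i j. exp (\<i> * complex_of_real (\<Phi> $ i $ j)))"
    by (simp add: phase_field_def scaleR_conv_of_real)
  then show "w \<in> phase_field E A ` unimodular"
    by (rule image_eqI) (simp add: unimodular_def)
next
  fix w :: "'n hspace ^ 'm"
  assume "w \<in> phase_field E A ` unimodular"
  then obtain u where u: "u \<in> unimodular" and w: "w = phase_field E A u"
    by blast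
  define \<Phi> :: "real ^ 'n ^ 'n" where "\<Phi> = (\<chi> i j. Arg (u $ i $ j))"
  have "u $ i $ j = exp (\<i> * complex_of_real (\<Phi> $ i $ j))" for i j
    using u Arg_eq[OF unimodular_nonzero[OF u, of i j]] by (simp add: unimodular_def \<Phi>_def)
  then have "w = diag (\<chi> c i j. complex_of_real (E c $ i $ j)
      * complex_of_real (A $ i $ j) * exp (\<i> * complex_of_real (\<Phi> $ i $ j)))"
    by (simp add: w phase_field_def scaleR_conv_of_real)
  then show "w \<in> {diag x | x. x \<in> chi_set E A}"
    by (auto simp: chi_set_def)
qed

lemma inner_phase_field:
  fixes X :: "'n::finite hspace ^ 'm"
  shows "inner X (phase_field E A u) = inner (aggregate E A X) u"
proof -
  let ?t = "\<lambda>d c i j. E c $ i $ j * A $ i $ j * inner (X $ d $ c $ i $ j) (u $ i $ j)"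
  have "inner X (phase_field E A u) = (\<Sum>d\<in>UNIV. \<Sum>c\<in>UNIV. \<Sum>i\<in>UNIV. \<Sum>j\<in>UNIV. ?t d c i j)"
    by (simp add: inner_vec_def phase_field_def diag_def)
  also have "\<dots> = (\<Sum>d\<in>UNIV. \<Sum>i\<in>UNIV. \<Sum>j\<in>UNIV. \<Sum>c\<in>UNIV. ?t d c i j)"
    by (subst sum.swap, subst (2) sum.swap) (rule refl)
  also have "\<dots> = (\<Sum>i\<in>UNIV. \<Sum>j\<in>UNIV. \<Sum>d\<in>UNIV. \<Sum>c\<in>UNIV. ?t d c i j)"
    by (subst sum.swap, subst (2) sum.swap) (rule refl)
  also have "\<dots> = inner (aggregate E A X) u"
    by (simp add: inner_vec_def aggregate_def inner_sum_left)
  finally show ?thesis .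
qed

lemma continuous_on_aggregate: "continuous_on S (\<lambda>X. aggregate E A X $ i $ j)"
  unfolding aggregate_def by (simp, intro continuous_intros)

lemma aggregate_phase_field:
  fixes E :: "chan \<Rightarrow> real ^ 'n ^ 'n"
  assumes "(\<Sum>c\<in>UNIV. (E c $ i $ j)\<^sup>2) = 2"
  shows "aggregate E A (phase_field E A u :: 'n::finite hspace ^ 'm) $ i $ j
    = (2 * real CARD('m) * (A $ i $ j)\<^sup>2) *\<^sub>R u $ i $ j"
proof -
  have "aggregate E A (phase_field E A u :: 'n hspace ^ 'm) $ i $ j
      = (\<Sum>d\<in>(UNIV :: 'm set). \<Sum>c\<in>UNIV. (E c $ i $ j * A $ i $ j)\<^sup>2 *\<^sub>R u $ i $ j)"
    by (simp add: aggregate_def phase_field_def diag_def power2_eq_square del: sum_constant)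
  also have "\<dots> = (\<Sum>d\<in>(UNIV :: 'm set). (2 * (A $ i $ j)\<^sup>2) *\<^sub>R u $ i $ j)"
    unfolding scaleR_sum_left[symmetric] power_mult_distrib sum_distrib_right[symmetric] assms ..
  also have "\<dots> = (2 * real CARD('m) * (A $ i $ j)\<^sup>2) *\<^sub>R u $ i $ j"
    unfolding sum_constant_scaleR by (simp only: scaleR_scaleR mult_ac)
  finally show ?thesis .
qed

section \<open>Prox-regularity\<close>

text \<open>
  The squared norm of a field is, by adjointness, the inner product of \<open>u\<close> with
  the aggregate of its own field; the entries of \<open>u\<close> enter only through their modulus.
\<close>

lemma norm_phase_field_unimodular:
  fixes E :: "chan \<Rightarrow> real ^ 'n ^ 'n"
  assumes E: "\<And>i j. (\<Sum>c\<in>UNIV. (E c $ i $ j)\<^sup>2) = 2"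
    and u: "u \<in> unimodular" and v: "v \<in> unimodular"
  shows "norm (phase_field E A u :: 'n::finite hspace ^ 'm)
    = norm (phase_field E A v :: 'n hspace ^ 'm)"
proof -
  have "inner (phase_field E A w :: 'n hspace ^ 'm) (phase_field E A w)
      = (\<Sum>i\<in>UNIV. \<Sum>j\<in>UNIV. 2 * real CARD('m) * (A $ i $ j)\<^sup>2)" if "w \<in> unimodular" for w
    using that unfolding inner_phase_field
    by (simp add: inner_vec_def[of "aggregate _ _ _"] inner_vec_def[of "_ $ _"]
          aggregate_phase_field[OF E] dot_square_norm unimodular_def)
  then show ?thesis
    using u v by (simp add: norm_eq)
qed

lemma projector_phase_fields:
  fixes E :: "chan \<Rightarrow> real ^ 'n ^ 'n" and X :: "'n::finite hspace ^ 'm"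
  assumes E: "\<And>i j. (\<Sum>c\<in>UNIV. (E c $ i $ j)\<^sup>2) = 2"
    and nz: "\<And>i j. aggregate E A X $ i $ j \<noteq> 0"
  shows "projector (phase_field E A ` unimodular) X = {phase_field E A (phases (aggregate E A X))}"
proof (rule projector_eq_if_strict_inner_max)
  let ?u = "phases (aggregate E A X)"
  have u: "?u \<in> unimodular"
    using nz by (rule phases_unimodular)
  then show "phase_field E A ?u \<in> phase_field E A ` unimodular"
    by (rule imageI)
  fix v :: "'n hspace ^ 'm"
  assume "v \<in> phase_field E A ` unimodular"
  then obtain u' where u': "u' \<in> unimodular" "v = phase_field E A u'"
    by blast
  show "norm v = norm (phase_field E A ?u :: 'n hspace ^ 'm)"
    unfolding u'(2) using E u'(1) u by (rule norm_phase_field_unimodular)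
  assume "v \<noteq> phase_field E A ?u"
  then have "u' \<noteq> ?u"
    using u'(2) by blast
  then show "inner X v < inner X (phase_field E A ?u)"
    unfolding u'(2) inner_phase_field using nz u'(1) by (intro inner_unimodular_less)
qed

theorem proposition5p7:
  fixes k :: "real ^ 3 ^ 'n ^ 'n"
    and A :: "real ^ 'n ^ 'n"
    and x_hat :: "'n::finite hspace"
  assumes "\<And>i j. norm (k $ i $ j) = 1"
    and "\<And>i j. 1 + k $ i $ j $ 3 \<noteq> 0"
    and "\<And>i j. A $ i $ j \<ge> 0"
    and "\<And>i j. A $ i $ j \<noteq> 0"
    and "x_hat \<in> chi_set (E_mat k) A"
  shows "prox_regular_at {diag x | x. x \<in> chi_set (E_mat k) A} (diag x_hat :: 'n hspace ^ 'm)"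
proof -
  let ?E = "E_mat k"
  let ?S = "phase_field ?E A ` unimodular :: ('n hspace ^ 'm) set"
  have E: "(\<Sum>c\<in>UNIV. (?E c $ i $ j)\<^sup>2) = 2" for i j
    using assms(1,2) by (rule sum_E_mat_squares)
  define U :: "('n hspace ^ 'm) set" where "U = {X. \<forall>i j. aggregate ?E A X $ i $ j \<noteq> 0}"
  have "U = (\<Inter>i. \<Inter>j. {X. aggregate ?E A X $ i $ j \<noteq> 0})"
    by (auto simp: U_def)
  then have "open U"
    by (auto intro!: open_INT open_Collect_neq continuous_on_aggregate)
  have in_S: "diag x_hat \<in> ?S"
    using assms(5) unfolding diag_chi_set_eq[symmetric] by blast
  then obtain u where u: "u \<in> unimodular" "diag x_hat = (phase_field ?E A u :: 'n hspace ^ 'm)"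
    by blast
  have "diag x_hat \<in> U"
    using assms(4) unimodular_nonzero[OF u(1)] unfolding U_def u(2)
    by (simp add: aggregate_phase_field[OF E])
  moreover have "\<exists>w. projector ?S X = {w}" if "X \<in> U" for X
    using that projector_phase_fields[OF E, of A X] by (auto simp: U_def)
  ultimately show ?thesis
    unfolding diag_chi_set_eq prox_regular_at_def using \<open>open U\<close> in_S by blast
qed

end
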